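(* Some languages which are not context-free are generated by SDL-grammars. Specifically, let $G$ be the SDL-grammar with terminal alphabet $\Sigma=\{a,b,c\}$, primitive types $\{b,c,x,y,z\}$, distinguished primitive type $x$, and lexical map $$l(a)=\{\,x/(c\multimap(b\multimap x)),\ x/(c\multimap(b\multimap y))\,\},$$ $$l(b)=\{\,(y/b)/y,\ (y/b)/z\,\},\qquad l(c)=\{\,(z/c)/z,\ z/c\,\}.$$ Then $L(G)=\{a^nb^nc^n : n\geq 1\}$.
   Context: Formulae (types) are built from a set of primitive types using the three binary connectives $/$, $\backslash$, $\multimap$ (no product). A sequent is a pair $U\Rightarrow A$ where $U$ is a finite sequence of formulae (order matters) and $A$ is a formula. $U,V,T$ denote finite sequences of formulae, and a comma denotes concatenation. In the claim the symbols $b,c$ are used both for terminals and for (distinct objects) primitive types. The semidirectional Lambek calculus SDL has the following axioms and rules. - (Ax): $p\Rightarrow p$ for $p$ primitive. - ($/L$): from $T\Rightarrow B$ and $U,A,V\Rightarrow C$ infer $U,A/B,T,V\Rightarrow C$. - ($/R$): from $U,B\Rightarrow A$ infer $U\Rightarrow A/B$, if $U$ is nonempty. - ($\backslash L$): from $T\Rightarrow B$ and $U,A,V\Rightarrow C$ infer $U,T,B\backslash A,V\Rightarrow C$. - ($\backslash R$): from $B,U\Rightarrow A$ infer $U\Rightarrow B\backslash A$, if $U$ is nonempty. - ($\multimap R$): from $U,B,V\Rightarrow A$ infer $U,V\Rightarrow B\multimap A$, if $(U,V)$ is nonempty. There is no left rule for $\multimap$. - (Cut): from $T\Rightarrow A$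 and $U,A,V\Rightarrow C$ infer $U,T,V\Rightarrow C$. Write $\vdash_{\mathrm{SDL}}U\Rightarrow A$ if the sequent is derivable. An SDL-grammar is a quadruple $\langle\Sigma,\mathcal F,b_S,l\rangle$, where $\Sigma$ is a finite alphabet, $\mathcal F$ is the set of all formulae over some set of primitive types containing the distinguished primitive type $b_S$, and $l$ maps each terminal in $\Sigma$ to a finite subset of $\mathcal F$. For $w_1\cdots w_n\in\Sigma^+$ put $l(w_1\cdots w_n)=l(w_1)\times\cdots\times l(w_n)$. The language $L(G)$ is the set of all $w_1\cdots w_n\in\Sigma^+$ for which there is a sequence of types $U\in l(w_1\cdots w_n)$ with $\vdash_{\mathrm{SDL}}U\Rightarrow b_S$. *)

theory Defs
  imports Main
begin

datatype (prims: 'p) form =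
    Prim 'p
  | Over "'p form" "'p form"  (infix "\<sslash>" 75)
  | Under "'p form" "'p form"  (infix "\<setminus>" 75)
  | Lolli "'p form" "'p form"  (infixr "\<multimap>" 70)

inductive SDL :: "'p form list \<Rightarrow> 'p form \<Rightarrow> bool"  (infix "\<turnstile>" 50) where
  Ax: "[Prim p] \<turnstile> Prim p"
| OverL: "T \<turnstile> B \<Longrightarrow> U @ [A] @ V \<turnstile> C \<Longrightarrow> U @ [A \<sslash> B] @ T @ V \<turnstile> C"
| OverR: "U @ [B] \<turnstile> A \<Longrightarrow> U \<noteq> [] \<Longrightarrow> U \<turnstile> A \<sslash> B"
| UnderL: "T \<turnstile> B \<Longrightarrow> U @ [A] @ V \<turnstile> C \<Longrightarrow> U @ T @ [B \<setminus> A] @ V \<turnstile> C"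
| UnderR: "[B] @ U \<turnstile> A \<Longrightarrow> U \<noteq> [] \<Longrightarrow> U \<turnstile> B \<setminus> A"
| LolliR: "U @ [B] @ V \<turnstile> A \<Longrightarrow> U @ V \<noteq> [] \<Longrightarrow> U @ V \<turnstile> B \<multimap> A"
| Cut: "T \<turnstile> A \<Longrightarrow> U @ [A] @ V \<turnstile> C \<Longrightarrow> U @ T @ V \<turnstile> C"

record ('t, 'p) sdl_grammar =
  alphabet :: "'t set"
  formulae :: "'p form set"
  start :: 'p
  lexicon :: "'t \<Rightarrow> 'p form set"

definition is_sdl_grammar :: "('t, 'p) sdl_grammar \<Rightarrow> bool" where
  "is_sdl_grammar G \<longleftrightarrow>
     finite (alphabet G) \<and>
     (\<exists>P. formulae G = {A. prims A \<subseteq> P} \<and> start G \<in> P) \<and>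
     (\<forall>t\<in>alphabet G. finite (lexicon G t) \<and> lexicon G t \<subseteq> formulae G)"

definition sdl_lang :: "('t, 'p) sdl_grammar \<Rightarrow> 't list set" where
  "sdl_lang G = {w. w \<noteq> [] \<and> set w \<subseteq> alphabet G \<and>
     (\<exists>U \<in> listset (map (lexicon G) w). U \<turnstile> Prim (start G))}"

datatype ('n, 't) symb = Nt 'n | Tm 't

inductive cfg_step ::
  "('n \<times> ('n, 't) symb list) set \<Rightarrow> ('n, 't) symb list \<Rightarrow> ('n, 't) symb list \<Rightarrow> bool"
  for P where
  "(A, \<alpha>) \<in> P \<Longrightarrow> cfg_step P (u @ [Nt A] @ v) (u @ \<alpha> @ v)"

definition cfg_lang :: "('n \<times> ('n, 't) symb list) set \<Rightarrow> 'n \<Rightarrow> 't list set" where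
  "cfg_lang P S = {w. (cfg_step P)\<^sup>*\<^sup>* [Nt S] (map Tm w)}"

text \<open>The type of potential nonterminals is a parameter. Finiteness of the set of productions
  means that only finitely many nonterminals and terminals matter.\<close>

definition context_free :: "'n itself \<Rightarrow> 't list set \<Rightarrow> bool" where
  "context_free (_ :: 'n itself) L \<longleftrightarrow>
     (\<exists>(P :: ('n \<times> ('n, 't) symb list) set) S. finite P \<and> L = cfg_lang P S)"

datatype terminal = Ta | Tb | Tc

datatype primitive = Pb | Pc | Px | Py | Pz

fun lex_abc :: "terminal \<Rightarrow> primitive form set" where
  "lex_abc Ta = {Prim Px \<sslash> (Prim Pc \<multimap> (Prim Pb \<multimap> Prim Px)),
                 Prim Px \<sslash> (Prim Pc \<multimap> (Prim Pb \<multimap> Prim Py))}"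
| "lex_abc Tb = {(Prim Py \<sslash> Prim Pb) \<sslash> Prim Py, (Prim Py \<sslash> Prim Pb) \<sslash> Prim Pz}"
| "lex_abc Tc = {(Prim Pz \<sslash> Prim Pc) \<sslash> Prim Pz, Prim Pz \<sslash> Prim Pc}"

definition G_abc :: "(terminal, primitive) sdl_grammar" where
  "G_abc = \<lparr>alphabet = {Ta, Tb, Tc}, formulae = {A. prims A \<subseteq> {Pb, Pc, Px, Py, Pz}},
            start = Px, lexicon = lex_abc\<rparr>"

end

theory Submission
  imports Defs
begin

text \<open>Upper bound on the language: formulae are interpreted as sets of strings of naturals, with
  \<open>/\<close> and \<open>\<setminus>\<close> read as residuals and \<open>B \<multimap> A\<close> as the strings that can be completed to an
  element of \<open>A\<close> by inserting any element of \<open>B\<close> at one suitable place. Since \<open>\<multimap>\<close> has no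
  left rule this is sound, Cut included, so no cut elimination is needed. In a model where \<open>x\<close>
  consists of the sorted strings \<open>a\<^sup>kb\<^sup>mc\<^sup>n\<gamma>\<^sup>n\<^sup>-\<^sup>k\<beta>\<^sup>m\<^sup>-\<^sup>k\<close> every terminal belongs to its lexical types.

  Non-context-freeness: replacing one yield of a nonterminal by another in a word of
  \<open>a\<^sup>nb\<^sup>nc\<^sup>n\<close> stays in the language, so if both yields lack \<open>c\<close> (or both lack \<open>a\<close>) they
  have the same length. Hence the factors of words of the language that are derived from a single
  nonterminal and lack \<open>a\<close> or \<open>c\<close> have bounded length; but long parse trees
  contain nodes whose yield is longer than that bound and still shorter than \<open>n\<close>.\<close>

section \<open>A string model of the calculus\<close>

fun interp :: "('p \<Rightarrow> 's list set) \<Rightarrow> 'p form \<Rightarrow> 's list set" where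
  "interp M (Prim p) = M p"
| "interp M (A \<sslash> B) = {w. \<forall>v\<in>interp M B. w @ v \<in> interp M A}"
| "interp M (B \<setminus> A) = {w. \<forall>v\<in>interp M B. v @ w \<in> interp M A}"
| "interp M (B \<multimap> A) = {u @ v | u v. \<forall>w\<in>interp M B. u @ w @ v \<in> interp M A}"

fun interp_seq :: "('p \<Rightarrow> 's list set) \<Rightarrow> 'p form list \<Rightarrow> 's list set" where
  "interp_seq M [] = {[]}"
| "interp_seq M (A # U) = {u @ v | u v. u \<in> interp M A \<and> v \<in> interp_seq M U}"

lemma interp_seq_append:
  "interp_seq M (U @ V) = {u @ v | u v. u \<in> interp_seq M U \<and> v \<in> interp_seq M V}"
proof (induction U)
  case (Cons A U)
  show ?case
    unfolding append_Cons interp_seq.simps Cons.IH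
    by (auto, (metis append_assoc)+)
qed simp

lemma interp_seq_single [simp]: "interp_seq M [A] = interp M A"
  by simp

lemma in_interp_seq_append:
  "w \<in> interp_seq M (U @ V) \<longleftrightarrow>
    (\<exists>u v. w = u @ v \<and> u \<in> interp_seq M U \<and> v \<in> interp_seq M V)"
  by (simp add: interp_seq_append)

lemma interp_seq_appendI:
  "u \<in> interp_seq M U \<Longrightarrow> v \<in> interp_seq M V \<Longrightarrow> u @ v \<in> interp_seq M (U @ V)"
  by (auto simp: in_interp_seq_append)

theorem SDL_sound: "U \<turnstile> A \<Longrightarrow> interp_seq M U \<subseteq> interp M A"
proof (induction rule: SDL.induct)
  case (Ax p)
  show ?case by simp
next
  case (OverL T B U A V C)
  show ?case
  proof
    fix w assume "w \<in> interp_seq M (U @ [A \<sslash> B] @ T @ V)"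
    then obtain u r t v where w: "w = u @ r @ t @ v" and "u \<in> interp_seq M U"
      "r \<in> interp M (A \<sslash> B)" "t \<in> interp_seq M T" "v \<in> interp_seq M V"
      unfolding in_interp_seq_append interp_seq_single by blast
    moreover from this have "r @ t \<in> interp M A" using OverL.IH(1) by auto
    ultimately have "u @ (r @ t) @ v \<in> interp_seq M (U @ [A] @ V)"
      by (intro interp_seq_appendI) simp_all
    then show "w \<in> interp M C" using OverL.IH(2) w by auto
  qed
next
  case (OverR U B A)
  show ?case
    using OverR.IH interp_seq_appendI[of _ M U _ "[B]"] by auto
next
  case (UnderL T B U A V C)
  show ?case
  proof
    fix w assume "w \<in> interp_seq M (U @ T @ [B \<setminus> A] @ V)"
    then obtain u r t v where w: "w = u @ t @ r @ v" and "u \<in> interp_seq M U"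
      "r \<in> interp M (B \<setminus> A)" "t \<in> interp_seq M T" "v \<in> interp_seq M V"
      unfolding in_interp_seq_append interp_seq_single by blast
    moreover from this have "t @ r \<in> interp M A" using UnderL.IH(1) by auto
    ultimately have "u @ (t @ r) @ v \<in> interp_seq M (U @ [A] @ V)"
      by (intro interp_seq_appendI) simp_all
    then show "w \<in> interp M C" using UnderL.IH(2) w by auto
  qed
next
  case (UnderR B U A)
  show ?case
    using UnderR.IH interp_seq_appendI[of _ M "[B]" _ U] by auto
next
  case (LolliR U B V A)
  show ?case
  proof
    fix w assume "w \<in> interp_seq M (U @ V)"
    then obtain u v where w: "w = u @ v" and uv: "u \<in> interp_seq M U" "v \<in> interp_seq M V"
      unfolding in_interp_seq_append by blast
    \<comment> \<open>The place from which \<open>B\<close> is withdrawn serves every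
      \<open>b\<close> at once, as the model of \<open>\<multimap>\<close> demands.\<close>
    have "u @ b @ v \<in> interp M A" if "b \<in> interp M B" for b
      using LolliR.IH uv that by (intro subsetD[OF LolliR.IH] interp_seq_appendI) simp_all
    then show "w \<in> interp M (B \<multimap> A)" using w by auto
  qed
next
  case (Cut T A U V C)
  show ?case
  proof
    fix w assume "w \<in> interp_seq M (U @ T @ V)"
    then obtain u t v where w: "w = u @ t @ v" and "u \<in> interp_seq M U"
      "t \<in> interp_seq M T" "v \<in> interp_seq M V"
      unfolding in_interp_seq_append by blast
    moreover from this have "t \<in> interp M A" using Cut.IH(1) by auto
    ultimately have "u @ t @ v \<in> interp_seq M (U @ [A] @ V)"
      by (intro interp_seq_appendI) simp_all
    then show "w \<in> interp M C" using Cut.IH(2) w by auto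
  qed
qed

text \<open>Reduces the use of \<open>SDL_sound\<close> for a grammar to one check per letter and
  lexical type.\<close>

lemma listset_in_interp_seq:
  assumes "U \<in> listset (map l w)" and "\<And>t A. A \<in> l t \<Longrightarrow> [f t] \<in> interp M A"
  shows "map f w \<in> interp_seq M U"
  using assms(1)
proof (induction w arbitrary: U)
  case (Cons t w)
  then obtain A V where "U = A # V" "A \<in> l t" "V \<in> listset (map l w)"
    by (auto simp: set_Cons_def)
  moreover from this have "[f t] @ map f w \<in> interp_seq M ([A] @ V)"
    using Cons.IH assms(2) by (intro interp_seq_appendI) simp_all
  ultimately show ?case by simp
qed simp

lemma interp_Lolli_singleton:
  assumes "M p = {[s]}"
  shows "w \<in> interp M (Prim p \<multimap> A) \<longleftrightarrow> (\<exists>u v. w = u @ v \<and> u @ s # v \<in> interp M A)"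
  using assms by simp

section \<open>The generated language\<close>

text \<open>Numbering the letters in block order makes \<open>sorted\<close> say that all a precede
  all b, and these all c.\<close>

fun tnum :: "terminal \<Rightarrow> nat" where
  "tnum Ta = 0"
| "tnum Tb = 1"
| "tnum Tc = 2"

text \<open>The letters 3 and 4 play the roles of \<open>\<gamma>\<close> and \<open>\<beta>\<close>, the elements of the
  primitive types \<open>c\<close> and \<open>b\<close>.\<close>

fun abc_model :: "primitive \<Rightarrow> nat list set" where
  "abc_model Pb = {[4]}"
| "abc_model Pc = {[3]}"
| "abc_model Px = {w. sorted w \<and> (\<forall>k\<in>set w. k \<le> 4) \<and>
     count_list w 1 = count_list w 0 + count_list w 4 \<and>
     count_list w 2 = count_list w 0 + count_list w 3}"
| "abc_model Py = {w. sorted w \<and> (\<forall>k\<in>set w. 1 \<le> k \<and> k \<le> 4) \<and>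
     count_list w 1 = count_list w 4 \<and> count_list w 2 = count_list w 3}"
| "abc_model Pz = {w. sorted w \<and> (\<forall>k\<in>set w. 2 \<le> k \<and> k \<le> 3) \<and>
     count_list w 2 = count_list w 3}"

lemma count_list_eq_0: "x \<notin> set w \<Longrightarrow> count_list w x = 0"
  by (simp add: count_list_0_iff)

lemma abc_model_Py_subset: "abc_model Py \<subseteq> abc_model Px"
proof
  fix w assume w: "w \<in> abc_model Py"
  then have "0 \<notin> set w" by auto
  then show "w \<in> abc_model Px" using w by (simp add: count_list_eq_0)
qed

lemma abc_model_Pz_subset: "abc_model Pz \<subseteq> abc_model Py"
proof
  fix w assume w: "w \<in> abc_model Pz"
  then have "1 \<notin> set w" "4 \<notin> set w" by auto
  moreover have "1 \<le> k \<and> k \<le> 4" if "k \<in> set w" for k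
    using w that by fastforce
  ultimately show "w \<in> abc_model Py" using w by (simp add: count_list_eq_0)
qed

text \<open>Deleting a 4 and a 3 lowers the right-hand sides of both count equations by one, which
  the new 0 makes up for; deletion keeps the word sorted, and 0 is the least letter. The 3 may stand
  on either side of the 4.\<close>

lemma abc_model_x_Cons:
  assumes "u1 @ 4 # v1 \<in> abc_model p" "u1 @ v1 = u @ 3 # v" "p \<in> {Px, Py}"
  shows "0 # u @ v \<in> abc_model Px"
proof -
  let ?w = "u1 @ 4 # v1" and ?w' = "u @ 3 # v"
  have "?w \<in> abc_model Px" using assms(1,3) abc_model_Py_subset by blast
  then have w: "sorted ?w" "\<forall>k\<in>set ?w. k \<le> 4"
    "count_list ?w 1 = count_list ?w 0 + count_list ?w 4"
    "count_list ?w 2 = count_list ?w 0 + count_list ?w 3"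
    unfolding abc_model.simps by blast+
  have *: "count_list (u1 @ v1) k = count_list ?w' k" for k
    by (simp only: assms(2))
  have "sorted (u1 @ v1)" "\<forall>k\<in>set (u1 @ v1). k \<le> 4"
    using w by (auto simp: sorted_append)
  then have "sorted ?w'" "\<forall>k\<in>set ?w'. k \<le> 4"
    unfolding assms(2) .
  then show ?thesis
    using w(3,4) *[of 0] *[of 1] *[of 2] *[of 3] *[of 4] by (auto simp: sorted_append)
qed

text \<open>For a, the two occurrences of \<open>\<multimap>\<close> insert a 3 and then a 4, the
  situation of \<open>abc_model_x_Cons\<close>. For b and c, enclosing a word between 1 and 4, or
  between 2 and 3, respects the order and adds one to both sides of a count equation.\<close>

lemma lex_abc_in_model:
  assumes "A \<in> lex_abc t"
  shows "[tnum t] \<in> interp abc_model A"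
proof (cases t)
  case Ta
  have "[0] \<in> interp abc_model (Prim Px \<sslash> (Prim Pc \<multimap> (Prim Pb \<multimap> Prim p)))"
    if "p \<in> {Px, Py}" for p
  proof -
    have "0 # w \<in> abc_model Px"
      if w: "w \<in> interp abc_model (Prim Pc \<multimap> (Prim Pb \<multimap> Prim p))" for w
    proof -
      from w obtain u v u1 v1 where "w = u @ v" "u1 @ v1 = u @ 3 # v" "u1 @ 4 # v1 \<in> abc_model p"
        by (auto simp: interp_Lolli_singleton)
      then show ?thesis using abc_model_x_Cons[of u1 v1 p u v] \<open>p \<in> {Px, Py}\<close> by simp
    qed
    then show ?thesis by (simp del: abc_model.simps interp.simps(4))
  qed
  then show ?thesis using assms Ta by (auto simp del: abc_model.simps interp.simps)
next
  case Tb
  have "1 # v @ [4] \<in> abc_model Py" if "v \<in> abc_model q" "q \<in> {Py, Pz}" for v q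
  proof -
    have "v \<in> abc_model Py" using that abc_model_Pz_subset by blast
    then show ?thesis by (auto simp: sorted_append)
  qed
  then show ?thesis using assms Tb by (auto simp del: abc_model.simps(3-5))
next
  case Tc
  have "2 # v @ [3] \<in> abc_model Pz" if "v \<in> abc_model Pz" for v
    using that by (auto simp: sorted_append)
  moreover have "[2, 3] \<in> abc_model Pz" by simp
  ultimately show ?thesis using assms Tc by (auto simp del: abc_model.simps(3-5))
qed

lemma sorted_tnum_eq:
  assumes "sorted (map tnum w)"
  shows "w = replicate (count_list w Ta) Ta @ replicate (count_list w Tb) Tb @
    replicate (count_list w Tc) Tc"
  using assms
proof (induction w)
  case (Cons t w)
  then have IH: "w = replicate (count_list w Ta) Ta @ replicate (count_list w Tb) Tb @
    replicate (count_list w Tc) Tc" and le: "\<forall>s\<in>set w. tnum t \<le> tnum s" by auto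
  show ?case
  proof (cases t)
    case Ta then show ?thesis using IH by simp
  next
    case Tb
    then have "count_list w Ta = 0" using le by (auto simp: count_list_0_iff)
    then show ?thesis using IH Tb by simp
  next
    case Tc
    then have "count_list w Ta = 0" "count_list w Tb = 0" using le by (auto simp: count_list_0_iff)
    then show ?thesis using IH Tc by simp
  qed
qed simp

lemma count_list_map_tnum: "count_list (map tnum w) (tnum t) = count_list w t"
proof -
  have "tnum s = tnum t \<longleftrightarrow> s = t" for s by (cases s; cases t) auto
  then show ?thesis by (induction w) auto
qed

abbreviation abc_word :: "nat \<Rightarrow> terminal list" where
  "abc_word n \<equiv> replicate n Ta @ replicate n Tb @ replicate n Tc"

text \<open>The image of a word has no 3 and no 4, so the count equations of \<open>Px\<close> force
  equally many a, b and c, and sortedness fixes their order.\<close>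

lemma sdl_lang_abc_subset: "sdl_lang G_abc \<subseteq> {abc_word n | n. n \<ge> 1}"
proof
  fix w assume "w \<in> sdl_lang G_abc"
  then obtain U where "w \<noteq> []" and U: "U \<in> listset (map lex_abc w)" "U \<turnstile> Prim Px"
    by (auto simp: sdl_lang_def G_abc_def)
  have "map tnum w \<in> abc_model Px"
    using SDL_sound[OF U(2), of abc_model] listset_in_interp_seq[OF U(1), of tnum abc_model]
      lex_abc_in_model unfolding interp.simps by blast
  moreover have "count_list (map tnum w) k = 0" if "k > 2" for k
  proof -
    have "tnum t \<le> 2" for t by (cases t) auto
    then have "k \<notin> set (map tnum w)" using that by (auto simp: not_le[symmetric])
    then show ?thesis by (rule count_list_eq_0)
  qed
  ultimately have "sorted (map tnum w)" "count_list w Tb = count_list w Ta"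
    "count_list w Tc = count_list w Ta"
    using count_list_map_tnum[of w Ta] count_list_map_tnum[of w Tb] count_list_map_tnum[of w Tc]
    by auto
  then have "w = abc_word (count_list w Ta)" using sorted_tnum_eq[of w] by simp
  moreover from this have "count_list w Ta \<noteq> 0" using \<open>w \<noteq> []\<close> by (metis append_Nil replicate_0)
  ultimately show "w \<in> {abc_word n | n. n \<ge> 1}" by (metis (mono_tags, lifting) mem_Collect_eq less_one not_le)
qed

section \<open>Derivations for the words of the language\<close>

lemma SDL_Over_apply:
  assumes "T \<turnstile> B"
  shows "[Prim p \<sslash> B] @ T \<turnstile> Prim p"
  using OverL[OF assms, of "[]" "Prim p" "[]" "Prim p"] Ax[of p] by simp

lemma SDL_Over_Over_apply:
  assumes "T \<turnstile> Prim q"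
  shows "[(Prim p \<sslash> Prim r) \<sslash> Prim q] @ T @ [Prim r] \<turnstile> Prim p"
  using OverL[OF assms, of "[]" "Prim p \<sslash> Prim r" "[Prim r]" "Prim p"]
    SDL_Over_apply[OF Ax, of p r] by simp

text \<open>Built from the inside outwards: each further type of c on the left cancels one more
  \<open>Prim Pc\<close> on the right.\<close>

lemma SDL_z:
  "replicate k ((Prim Pz \<sslash> Prim Pc) \<sslash> Prim Pz) @ [Prim Pz \<sslash> Prim Pc] @ replicate (Suc k) (Prim Pc)
     \<turnstile> Prim Pz"
proof (induction k)
  case 0
  show ?case using SDL_Over_apply[OF Ax, of Pz Pc] by simp
next
  case (Suc k)
  show ?case using SDL_Over_Over_apply[OF Suc, of Pz Pc]
    by (simp add: replicate_app_Cons_same)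
qed

lemma SDL_y:
  assumes "Z \<turnstile> Prim Pz"
  shows "replicate k ((Prim Py \<sslash> Prim Pb) \<sslash> Prim Py) @ [(Prim Py \<sslash> Prim Pb) \<sslash> Prim Pz] @ Z @
    replicate (Suc k) (Prim Pb) \<turnstile> Prim Py"
proof (induction k)
  case 0
  show ?case using SDL_Over_Over_apply[OF assms, of Py Pb] by simp
next
  case (Suc k)
  show ?case using SDL_Over_Over_apply[OF Suc, of Py Pb]
    by (simp add: replicate_app_Cons_same)
qed

text \<open>\<open>LolliR\<close> can withdraw hypotheses from inside the sequent: a b at the border
  of the two blocks, then a c next to \<open>W\<close>. Nonemptiness of \<open>W\<close> gives the
  side condition when \<open>i\<close> and \<open>j\<close> are 0.\<close>

lemma SDL_x_step:
  assumes "W @ replicate (Suc i) (Prim Pc) @ replicate (Suc j) (Prim Pb) \<turnstile> Prim p" "W \<noteq> []"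
  shows "[Prim Px \<sslash> (Prim Pc \<multimap> (Prim Pb \<multimap> Prim p))] @ W @
    replicate i (Prim Pc) @ replicate j (Prim Pb) \<turnstile> Prim Px"
proof (rule SDL_Over_apply)
  have "(W @ replicate (Suc i) (Prim Pc)) @ replicate j (Prim Pb) \<turnstile> Prim Pb \<multimap> Prim p"
    using assms by (intro LolliR) simp_all
  then show "W @ replicate i (Prim Pc) @ replicate j (Prim Pb) \<turnstile> Prim Pc \<multimap> (Prim Pb \<multimap> Prim p)"
    using LolliR[of W "Prim Pc" "replicate i (Prim Pc) @ replicate j (Prim Pb)"] assms(2) by simp
qed

text \<open>The \<open>i\<close> pairs of pending hypotheses strengthen the induction: a further a
  in front discharges one pair, so the case of \<open>i\<close> rests on that of
  \<open>Suc i\<close>. With \<open>i = 0\<close> nothing is left pending.\<close>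

lemma SDL_x:
  assumes "W @ replicate (Suc k + i) (Prim Pc) @ replicate (Suc k + i) (Prim Pb) \<turnstile> Prim Py"
    and "W \<noteq> []"
  shows "replicate k (Prim Px \<sslash> (Prim Pc \<multimap> (Prim Pb \<multimap> Prim Px))) @
    [Prim Px \<sslash> (Prim Pc \<multimap> (Prim Pb \<multimap> Prim Py))] @ W @
    replicate i (Prim Pc) @ replicate i (Prim Pb) \<turnstile> Prim Px"
  using assms(1)
proof (induction k arbitrary: i)
  case 0
  then show ?case using SDL_x_step[OF _ assms(2), of i i Py] by simp
next
  case (Suc k)
  show ?case using Suc.IH[of "Suc i"] Suc.prems
      SDL_x_step[of "replicate k (Prim Px \<sslash> (Prim Pc \<multimap> (Prim Pb \<multimap> Prim Px))) @
        [Prim Px \<sslash> (Prim Pc \<multimap> (Prim Pb \<multimap> Prim Py))] @ W" i i Px]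
    by simp
qed

lemma listset_append:
  "U \<in> listset As \<Longrightarrow> V \<in> listset Bs \<Longrightarrow> U @ V \<in> listset (As @ Bs)"
  by (induction As arbitrary: U) (auto simp: set_Cons_def)

lemma replicate_in_listset: "A \<in> S \<Longrightarrow> replicate k A \<in> listset (replicate k S)"
  by (induction k) (auto simp: set_Cons_def)

lemma abc_word_in_sdl_lang: "abc_word (Suc k) \<in> sdl_lang G_abc"
proof -
  \<comment> \<open>The last letter of each block gets the type that changes phase: from x to y,
    from y to z, and for c the one that ends the recursion.\<close>
  let ?A = "replicate k (Prim Px \<sslash> (Prim Pc \<multimap> (Prim Pb \<multimap> Prim Px))) @
    [Prim Px \<sslash> (Prim Pc \<multimap> (Prim Pb \<multimap> Prim Py))]"
  let ?B = "replicate k ((Prim Py \<sslash> Prim Pb) \<sslash> Prim Py) @ [(Prim Py \<sslash> Prim Pb) \<sslash> Prim Pz]"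
  let ?C = "replicate k ((Prim Pz \<sslash> Prim Pc) \<sslash> Prim Pz) @ [Prim Pz \<sslash> Prim Pc]"
  have rep: "replicate k A @ [B] \<in> listset (replicate (Suc k) S)"
    if "A \<in> S" "B \<in> S" for A B :: "primitive form" and S
    using listset_append[of "replicate k A" "replicate k S" "[B]" "[S]"]
      replicate_in_listset[OF that(1), of k] that(2)
    by (simp add: replicate_append_same set_Cons_def)
  have "?A @ ?B @ ?C \<in> listset (map lex_abc (abc_word (Suc k)))"
    unfolding map_append map_replicate by (intro listset_append rep) simp_all
  moreover have "?A @ ?B @ ?C \<turnstile> Prim Px"
    using SDL_x[of "?B @ ?C" k 0] SDL_y[OF SDL_z, of k k] by simp
  ultimately show ?thesis
    by (auto simp: sdl_lang_def G_abc_def)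
qed

lemma sdl_lang_abc: "sdl_lang G_abc = {abc_word n | n. n \<ge> 1}"
proof
  show "{abc_word n | n. n \<ge> 1} \<subseteq> sdl_lang G_abc"
    using abc_word_in_sdl_lang by (auto dest!: Suc_le_D)
qed (rule sdl_lang_abc_subset)

section \<open>Context-free grammars\<close>

text \<open>Big-step counterpart of \<open>cfg_step\<close>: a derivation is a parse forest with
  roots \<open>\<alpha>\<close> and leaves \<open>w\<close>, so rule induction is induction on parse
  trees.\<close>

inductive yields :: "('n \<times> ('n, 't) symb list) set \<Rightarrow> ('n, 't) symb list \<Rightarrow> 't list \<Rightarrow> bool"
  for P where
  yields_Nil: "yields P [] []"
| yields_Tm: "yields P \<alpha> w \<Longrightarrow> yields P (Tm t # \<alpha>) (t # w)"
| yields_Nt: "(A, \<beta>) \<in> P \<Longrightarrow> yields P \<beta> w \<Longrightarrow> yields P \<alpha> v \<Longrightarrow> yields P (Nt A # \<alpha>) (w @ v)"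

inductive_cases yields_TmE: "yields P (Tm t # \<alpha>) w"
inductive_cases yields_NtE: "yields P (Nt A # \<alpha>) w"

lemma yields_append: "yields P \<alpha> u \<Longrightarrow> yields P \<beta> v \<Longrightarrow> yields P (\<alpha> @ \<beta>) (u @ v)"
  by (induction rule: yields.induct) (auto intro: yields.intros)

lemma yields_appendE:
  assumes "yields P (\<alpha> @ \<beta>) w"
  obtains u v where "w = u @ v" "yields P \<alpha> u" "yields P \<beta> v"
  using assms
proof (induction \<alpha> arbitrary: w thesis)
  case Nil
  then show ?case by (auto intro: yields_Nil)
next
  case (Cons s \<alpha>)
  show ?case
  proof (cases s)
    case (Nt A)
    with Cons.prems(2) obtain \<gamma> w1 w2 where "(A, \<gamma>) \<in> P" "yields P \<gamma> w1" "yields P (\<alpha> @ \<beta>) w2"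
      "w = w1 @ w2" by (auto elim: yields_NtE)
    then show ?thesis using Cons.IH Cons.prems(1) Nt by (metis append_assoc yields_Nt)
  next
    case (Tm t)
    with Cons.prems(2) obtain w2 where "yields P (\<alpha> @ \<beta>) w2" "w = t # w2"
      by (auto elim: yields_TmE)
    then show ?thesis using Cons.IH Cons.prems(1) Tm by (metis append_Cons yields_Tm)
  qed
qed

lemma yields_map_Tm: "yields P (map Tm w) w"
  by (induction w) (auto intro: yields.intros)

lemma cfg_step_yields:
  assumes "cfg_step P \<alpha> \<beta>" "yields P \<beta> w"
  shows "yields P \<alpha> w"
  using assms
proof cases
  case (1 A \<gamma> u v)
  obtain x y z where w: "w = x @ y @ z" and "yields P u x" "yields P \<gamma> y" "yields P v z"
    using assms(2) unfolding 1(2) by (elim yields_appendE) auto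
  then have "yields P (u @ Nt A # v) (x @ y @ z)"
    using 1(3) by (intro yields_append yields_Nt)
  then show ?thesis using 1(1) w by simp
qed

lemma cfg_step_context:
  assumes "cfg_step P \<alpha> \<beta>"
  shows "cfg_step P (u @ \<alpha> @ v) (u @ \<beta> @ v)"
  using assms
proof cases
  case (1 A \<gamma> u' v')
  then show ?thesis using cfg_step.intros[OF 1(3), of "u @ u'" "v' @ v"] by simp
qed

lemma cfg_steps_context:
  "(cfg_step P)\<^sup>*\<^sup>* \<alpha> \<beta> \<Longrightarrow> (cfg_step P)\<^sup>*\<^sup>* (u @ \<alpha> @ v) (u @ \<beta> @ v)"
  by (induction rule: rtranclp_induct) (auto intro: rtranclp.rtrancl_into_rtrancl cfg_step_context)

lemma yields_iff_cfg_steps: "yields P \<alpha> w \<longleftrightarrow> (cfg_step P)\<^sup>*\<^sup>* \<alpha> (map Tm w)"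
proof
  assume "(cfg_step P)\<^sup>*\<^sup>* \<alpha> (map Tm w)"
  then show "yields P \<alpha> w"
    by (induction rule: converse_rtranclp_induct) (auto intro: yields_map_Tm cfg_step_yields)
next
  assume "yields P \<alpha> w"
  then show "(cfg_step P)\<^sup>*\<^sup>* \<alpha> (map Tm w)"
  proof induction
    case (yields_Tm \<alpha> w t)
    then show ?case using cfg_steps_context[of P \<alpha> "map Tm w" "[Tm t]" "[]"] by simp
  next
    case (yields_Nt A \<beta> w \<alpha> v)
    have "cfg_step P (Nt A # \<alpha>) (\<beta> @ \<alpha>)"
      using cfg_step.intros[OF yields_Nt(1), of "[]" \<alpha>] by simp
    moreover have "(cfg_step P)\<^sup>*\<^sup>* (\<beta> @ \<alpha>) (map Tm w @ \<alpha>)"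
      using cfg_steps_context[OF yields_Nt.IH(1), of "[]" \<alpha>] by simp
    moreover have "(cfg_step P)\<^sup>*\<^sup>* (map Tm w @ \<alpha>) (map Tm w @ map Tm v)"
      using cfg_steps_context[OF yields_Nt.IH(2), of "map Tm w" "[]"] by simp
    ultimately show ?case by (metis (no_types) converse_rtranclp_into_rtranclp map_append rtranclp_trans)
  qed simp
qed

lemma cfg_lang_eq_yields: "cfg_lang P S = {w. yields P [Nt S] w}"
  by (simp add: cfg_lang_def yields_iff_cfg_steps)

text \<open>A minimal parse tree node with yield longer than \<open>K\<close> has yield of length at most
  \<open>K * d\<close>, since each of its at most \<open>d\<close> children contributes at most \<open>K\<close>.\<close>

lemma yields_medium_factor:
  assumes "yields P \<alpha> w" and "K * length \<alpha> < length w" and "1 \<le> K"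
    and d: "\<forall>r\<in>P. length (snd r) \<le> d"
  shows "\<exists>A x u v. w = u @ x @ v \<and> yields P [Nt A] x \<and> K < length x \<and> length x \<le> K * d \<and>
    (\<forall>y. yields P [Nt A] y \<longrightarrow> yields P \<alpha> (u @ y @ v))"
  using assms(1,2)
proof induction
  case (yields_Tm \<alpha> w t)
  \<comment> \<open>A terminal contributes one symbol, which is within the allowance of
    \<open>K\<close> per root.\<close>
  then have "K * length \<alpha> < length w" using \<open>1 \<le> K\<close> by simp
  from yields_Tm.IH[OF this] obtain A x u v where
    *: "w = u @ x @ v" "yields P [Nt A] x" "K < length x" "length x \<le> K * d"
      "\<forall>y. yields P [Nt A] y \<longrightarrow> yields P \<alpha> (u @ y @ v)"
    by blast
  have "\<forall>y. yields P [Nt A] y \<longrightarrow> yields P (Tm t # \<alpha>) ((t # u) @ y @ v)"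
    using *(5) by (auto intro: yields.yields_Tm)
  then show ?case using * by (metis append_Cons)
next
  case (yields_Nt A \<beta> w \<alpha> v)
  have A: "yields P [Nt A] w"
    using yields.yields_Nt[OF yields_Nt(1,2) yields_Nil] by simp
  \<comment> \<open>A yield of at most \<open>K\<close> leaves more than \<open>K\<close> per
    remaining root, so the search moves right; one above \<open>K * d\<close> exceeds
    \<open>K\<close> per child, so it descends; in between, \<open>A\<close> itself serves.\<close>
  consider "length w \<le> K" | "K < length w" "length w \<le> K * d" | "K * d < length w"
    by linarith
  then show ?case
  proof cases
    case 1
    then have "K * length \<alpha> < length v" using yields_Nt.prems by simp
    from yields_Nt.IH(2)[OF this] obtain B x u u' where
      *: "v = u @ x @ u'" "yields P [Nt B] x" "K < length x" "length x \<le> K * d"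
        "\<forall>y. yields P [Nt B] y \<longrightarrow> yields P \<alpha> (u @ y @ u')"
      by blast
    have "\<forall>y. yields P [Nt B] y \<longrightarrow> yields P (Nt A # \<alpha>) ((w @ u) @ y @ u')"
      using *(5) yields_Nt(1,2) by (auto intro: yields.yields_Nt)
    then show ?thesis using * by (metis append_assoc)
  next
    case 2
    have "\<forall>y. yields P [Nt A] y \<longrightarrow> yields P (Nt A # \<alpha>) ([] @ y @ v)"
      using yields_append[OF _ yields_Nt(3), of "[Nt A]"] by simp
    then show ?thesis using 2 A by (metis append_Nil)
  next
    case 3
    then have "K * length \<beta> < length w"
      using mult_le_mono2[OF bspec[OF d yields_Nt(1)], of K] unfolding snd_conv by linarith
    from yields_Nt.IH(1)[OF this] obtain B x u u' where
      *: "w = u @ x @ u'" "yields P [Nt B] x" "K < length x" "length x \<le> K * d"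
        "\<forall>y. yields P [Nt B] y \<longrightarrow> yields P \<beta> (u @ y @ u')"
      by blast
    have "yields P (Nt A # \<alpha>) (u @ y @ u' @ v)" if "yields P [Nt B] y" for y
      using yields.yields_Nt[OF yields_Nt(1) _ yields_Nt(3), of "u @ y @ u'"] *(5) that by simp
    then show ?thesis using * by (metis append_assoc)
  qed
qed simp

section \<open>Bounded factors and non-context-freeness\<close>

text \<open>The context must accept every yield of \<open>A\<close>, not just \<open>x\<close>, so
  that yields can be exchanged.\<close>

definition factor_yield ::
  "('n \<times> ('n, 't) symb list) set \<Rightarrow> 't list set \<Rightarrow> 'n \<Rightarrow> 't list \<Rightarrow> bool" where
  "factor_yield P L A x \<longleftrightarrow> yields P [Nt A] x \<and>
     (\<exists>u v. \<forall>y. yields P [Nt A] y \<longrightarrow> u @ y @ v \<in> L)"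

text \<open>Put \<open>y\<close> into the context of \<open>x\<close>: all occurrences of
  \<open>t\<close> lie in the context, and their number determines the whole word.\<close>

lemma abc_factor_yield_length_unique:
  assumes "factor_yield P {abc_word n | n. n \<ge> 1} A x" "factor_yield P {abc_word n | n. n \<ge> 1} A y"
    and "t \<notin> set x" "t \<notin> set y"
  shows "length x = length y"
proof -
  obtain u v m n where mn: "u @ x @ v = abc_word m" "u @ y @ v = abc_word n"
    using assms(1,2) unfolding factor_yield_def by blast
  have count: "count_list (abc_word k) t = k" for k
  proof -
    have "count_list (replicate k s) t = (if s = t then k else 0)" for s
      by (induction k) auto
    then show ?thesis by (cases t) auto
  qed
  have "m = n"
    using arg_cong[OF mn(1), of "\<lambda>w. count_list w t"] arg_cong[OF mn(2), of "\<lambda>w. count_list w t"]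
      assms(3,4) unfolding count by (simp add: count_list_eq_0)
  then show ?thesis using mn by (metis add_left_cancel add_right_cancel length_append)
qed

text \<open>For one \<open>A\<close> all such yields have equal length; a maximum over the finite
  \<open>N\<close> makes the bound uniform.\<close>

lemma abc_factor_yield_bound:
  assumes "finite N"
  shows "\<exists>B. \<forall>A\<in>N. \<forall>x. factor_yield P {abc_word n | n. n \<ge> 1} A x \<longrightarrow> t \<notin> set x \<longrightarrow> length x \<le> B"
proof -
  define Q where "Q A x \<longleftrightarrow> factor_yield P {abc_word n | n. n \<ge> 1} A x \<and> t \<notin> set x" for A x
  have "length x = length y" if "Q A x" "Q A y" for A x y
    using that unfolding Q_def by (elim conjE) (rule abc_factor_yield_length_unique)
  then have "\<exists>B. \<forall>x. Q A x \<longrightarrow> length x \<le> B" for A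
    by (metis order_refl)
  then obtain f where f: "\<And>A x. Q A x \<Longrightarrow> length x \<le> f A"
    by metis
  have "length x \<le> Max (f ` N)" if "A \<in> N" "Q A x" for A x
    using f[OF that(2)] that(1) assms by (meson Max_ge finite_imageI imageI order_trans)
  then show ?thesis unfolding Q_def by blast
qed

text \<open>A factor that meets both outer blocks contains the whole block of b.\<close>

lemma abc_word_factor_length:
  assumes "u @ x @ v = abc_word n" "Ta \<in> set x" "Tc \<in> set x"
  shows "n \<le> length x"
proof -
  have "sorted (map tnum (abc_word n))"
    by (auto simp: sorted_append sorted_replicate)
  then have "sorted (map tnum (u @ x @ v))" using assms(1) by simp
  then have "Tb \<notin> set u" "Tb \<notin> set v" using assms(2,3) by (force simp: sorted_append)+
  then have "count_list (u @ x @ v) Tb = count_list x Tb"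
    by (simp add: count_list_eq_0)
  moreover have "count_list (abc_word n) Tb = n"
    by (induction n) (auto simp: count_list_eq_0)
  ultimately show ?thesis using assms(1) count_le_length[of x Tb] by simp
qed

theorem abc_not_context_free: "\<not> context_free TYPE('n) {abc_word n | n. n \<ge> 1}"
proof
  let ?L = "{abc_word n | n. n \<ge> 1}"
  assume "context_free TYPE('n) ?L"
  then obtain P :: "('n \<times> ('n, terminal) symb list) set" and S
    where "finite P" and L: "?L = {w. yields P [Nt S] w}"
    by (auto simp: context_free_def cfg_lang_eq_yields)
  \<comment> \<open>The type \<open>'n\<close> may be infinite, but any nonterminal with a yield is
    the left-hand side of one of finitely many productions.\<close>
  let ?N = "fst ` P"
  have "finite ?N" using \<open>finite P\<close> by simp
  obtain B1 B2 where
    B: "\<And>A x. A \<in> ?N \<Longrightarrow> factor_yield P ?L A x \<Longrightarrow> Ta \<notin> set x \<Longrightarrow> length x \<le> B1"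
      "\<And>A x. A \<in> ?N \<Longrightarrow> factor_yield P ?L A x \<Longrightarrow> Tc \<notin> set x \<Longrightarrow> length x \<le> B2"
    using abc_factor_yield_bound[OF \<open>finite ?N\<close>, of P Ta]
      abc_factor_yield_bound[OF \<open>finite ?N\<close>, of P Tc] by meson
  \<comment> \<open>Anything longer than \<open>K\<close> exceeds both bounds; the successor also
    ensures \<open>1 \<le> K\<close>.\<close>
  define K where "K = Suc (max B1 B2)"
  \<comment> \<open>The successor keeps \<open>d\<close> positive, so that
    \<open>K \<le> K * d\<close>.\<close>
  define d where "d = Suc (Max (length ` snd ` P))"
  have d: "\<forall>r\<in>P. length (snd r) \<le> d"
    using \<open>finite P\<close> by (simp add: d_def le_SucI)
  \<comment> \<open>Large enough that the whole word is longer than \<open>K\<close>, and that no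
    factor of length at most \<open>K * d\<close> contains both a and c.\<close>
  define n where "n = Suc (K * d)"
  have "1 \<le> n" by (simp add: n_def)
  then have "abc_word n \<in> ?L" by blast
  then have w: "yields P [Nt S] (abc_word n)" unfolding L by simp
  have "K \<le> K * d" "1 \<le> K" by (simp_all add: d_def K_def)
  then have "K < n" unfolding n_def by linarith
  then have "K * length [Nt S] < length (abc_word n)" by simp
  from yields_medium_factor[OF w this \<open>1 \<le> K\<close> d]
  obtain A x u v where x: "abc_word n = u @ x @ v" "yields P [Nt A] x" "K < length x"
    "length x \<le> K * d" "\<forall>y. yields P [Nt A] y \<longrightarrow> yields P [Nt S] (u @ y @ v)"
    by (elim exE conjE) (rule that)
  have "A \<in> ?N" using x(2) by (force elim: yields_NtE)
  moreover have "factor_yield P ?L A x"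
    unfolding factor_yield_def L using x(2,5) by blast
  moreover have "Ta \<notin> set x \<or> Tc \<notin> set x"
    using abc_word_factor_length[OF x(1)[symmetric]] x(4) by (auto simp: n_def)
  ultimately have "length x \<le> max B1 B2" using B by (meson le_max_iff_disj)
  then show False using x(3) by (simp add: K_def)
qed

lemma is_sdl_grammar_G_abc: "is_sdl_grammar G_abc"
proof -
  have "finite (lex_abc t) \<and> lex_abc t \<subseteq> {A. prims A \<subseteq> {Pb, Pc, Px, Py, Pz}}" for t
    by (cases t) auto
  then show ?thesis unfolding is_sdl_grammar_def G_abc_def by auto
qed

theorem mainTheorem3:
  shows "is_sdl_grammar G_abc \<and>
    sdl_lang G_abc = {replicate n Ta @ replicate n Tb @ replicate n Tc | n. n \<ge> 1} \<and>
    \<not> context_free TYPE('n) (sdl_lang G_abc)"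
  using is_sdl_grammar_G_abc abc_not_context_free unfolding sdl_lang_abc by blast

end
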